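(* For every fixed integer $s \geq 2$, $Q(s,r) = (1+o(1)) \log_2 r$, where the $o(1)$-term tends to $0$ as $r$ tends to infinity. That is, for every $s\ge 2$ and every $\delta>0$ there is $r_0$ such that for all $r \ge r_0$, $(1-\delta)\log_2 r \le Q(s,r) \le (1+\delta)\log_2 r$.
   Context: The product dimension of a finite graph $G$ is the minimum possible number $d$ of proper vertex colorings of $G$ such that for every pair $u,v$ of distinct non-adjacent vertices there is at least one of the $d$ colorings in which $u$ and $v$ receive the same color. For integers $s,r \geq 2$, $K_s(r)$ denotes the graph consisting of $r$ pairwise vertex-disjoint copies of the complete graph $K_s$, and $Q(s,r)$ denotes the product dimension of $K_s(r)$. *)

theory Defs
  imports "HOL-Analysis.Analysis"
begin

text \<open>A finite simple graph is given by a vertex set V and a symmetric irreflexive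
adjacency relation E. A proper vertex colouring assigns colours (natural numbers)
to vertices so that adjacent vertices get different colours.\<close>

definition proper_coloring :: "'a set \<Rightarrow> ('a \<Rightarrow> 'a \<Rightarrow> bool) \<Rightarrow> ('a \<Rightarrow> nat) \<Rightarrow> bool" where
  "proper_coloring V E c \<longleftrightarrow> (\<forall>u\<in>V. \<forall>v\<in>V. E u v \<longrightarrow> c u \<noteq> c v)"

definition product_dimension :: "'a set \<Rightarrow> ('a \<Rightarrow> 'a \<Rightarrow> bool) \<Rightarrow> nat" where
  "product_dimension V E =
     (LEAST d. \<exists>c :: nat \<Rightarrow> 'a \<Rightarrow> nat.
        (\<forall>i<d. proper_coloring V E (c i)) \<and>
        (\<forall>u\<in>V. \<forall>v\<in>V. u \<noteq> v \<and> \<not> E u v \<longrightarrow> (\<exists>i<d. c i u = c i v)))"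

text \<open>K_s(r): r vertex-disjoint copies of K_s, with vertex (i,a) meaning vertex a
of copy i.\<close>

definition Ksr_vertices :: "nat \<Rightarrow> nat \<Rightarrow> (nat \<times> nat) set" where
  "Ksr_vertices s r = {0..<r} \<times> {0..<s}"

definition Ksr_adj :: "(nat \<times> nat) \<Rightarrow> (nat \<times> nat) \<Rightarrow> bool" where
  "Ksr_adj u v \<longleftrightarrow> fst u = fst v \<and> snd u \<noteq> snd v"

definition Q :: "nat \<Rightarrow> nat \<Rightarrow> nat" where
  "Q s r = product_dimension (Ksr_vertices s r) Ksr_adj"

end

theory Submission
  imports Defs
begin

text \<open>
  Lower bound: if \<open>x\<^sub>i\<close> and \<open>y\<^sub>i\<close> are the colour vectors of two vertices of the \<open>i\<close>-th clique, then
  \<open>\<Prod>\<^sub>t (x\<^sub>i t - y\<^sub>j t)\<close> vanishes exactly for \<open>i \<noteq> j\<close>; expanding the product shows that this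
  nonsingular \<open>r \<times> r\<close> matrix has rank at most \<open>2\<^sup>d\<close>.

  Upper bound: give the \<open>a\<close>-th vertex of the clique \<open>u\<close> the colour \<open>W u t XOR 2\<^sup>a\<close> in the \<open>t\<close>-th
  colouring. It then suffices to find about \<open>2\<^sup>l\<close> words \<open>W u\<close> of length \<open>l\<close> such that the pointwise
  XOR of any two of them takes each of the values \<open>2\<^sup>a XOR 2\<^sup>b\<close>. Such words are built by adding
  one required value \<open>d\<close> at a time: a sequence \<open>u\<^sub>1, \<dots>, u\<^sub>k\<close> of old indices is encoded by \<open>k + 1\<close>
  blocks, where block \<open>j\<close> is the old word of \<open>u\<^sub>j\<close> XORed with \<open>d\<close> times the binary expansion of
  \<open>u\<^sub>j\<^sub>+\<^sub>1\<close>, and \<open>u\<^sub>0\<close>, \<open>u\<^sub>k\<^sub>+\<^sub>1\<close> are constant. For two distinct sequences, the block of the last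
  difference yields the old values and the block before the first difference yields \<open>d\<close>.
\<close>

section \<open>Lower bound\<close>

text \<open>Gaussian elimination, by induction on the equations \<open>S\<close>: an unknown
  \<open>p\<close> with nonzero coefficient in equation \<open>k\<close> is eliminated, which
  removes one equation and one unknown.\<close>

lemma nontrivial_solution:
  fixes a :: "'i \<Rightarrow> 'k \<Rightarrow> 'f::field"
  assumes "finite S" "finite I" "card S < card I"
  shows "\<exists>c. (\<exists>i\<in>I. c i \<noteq> 0) \<and> (\<forall>k\<in>S. (\<Sum>i\<in>I. c i * a i k) = 0)"
  using assms
proof (induction S arbitrary: I a rule: finite_induct)
  case empty
  then obtain i where "i \<in> I"
    by fastforce
  then show ?case
    by (intro exI[of _ "\<lambda>_. 1"]) auto
next
  case (insert k S)
  show ?case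
  proof (cases "\<forall>i\<in>I. a i k = 0")
    case True
    have "card S < card I"
      using insert by simp
    from insert.IH[OF insert.prems(1) this, of a] show ?thesis
      using True by auto
  next
    case False
    then obtain p where p: "p \<in> I" "a p k \<noteq> 0"
      by auto
    define b where "b i l = a i l - a i k / a p k * a p l" for i l
    have "card S < card (I - {p})"
      using insert p by simp
    from insert.IH[OF _ this, of b] insert.prems(1) obtain c where
      c: "\<exists>i\<in>I - {p}. c i \<noteq> 0" "\<And>l. l \<in> S \<Longrightarrow> (\<Sum>i\<in>I - {p}. c i * b i l) = 0"
      by auto
    \<comment> \<open>The value at \<open>p\<close> is the one forced by equation
      \<open>k\<close>.\<close>
    define e where "e = c(p := - (\<Sum>i\<in>I - {p}. c i * a i k) / a p k)"
    have split: "(\<Sum>i\<in>I. e i * a i l) = (\<Sum>i\<in>I - {p}. c i * b i l)" for l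
    proof -
      have "(\<Sum>i\<in>I. e i * a i l) = e p * a p l + (\<Sum>i\<in>I - {p}. e i * a i l)"
        using p insert.prems(1) by (simp add: sum.remove)
      also have "(\<Sum>i\<in>I - {p}. e i * a i l) = (\<Sum>i\<in>I - {p}. c i * a i l)"
        by (intro sum.cong) (auto simp: e_def)
      also have "e p * a p l = - (\<Sum>i\<in>I - {p}. c i * (a i k / a p k * a p l))"
        by (simp add: e_def sum_distrib_right sum_divide_distrib mult.assoc)
      finally show ?thesis
        by (simp add: b_def right_diff_distrib sum_subtractf)
    qed
    have "b i k = 0" for i
      using p by (simp add: b_def)
    then have "\<forall>l\<in>insert k S. (\<Sum>i\<in>I. e i * a i l) = 0"
      using c(2) by (auto simp: split)
    moreover have "\<exists>i\<in>I. e i \<noteq> 0"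
      using c(1) by (auto simp: e_def)
    ultimately show ?thesis
      by blast
  qed
qed

text \<open>If \<open>r\<close> exceeded the number of subsets of \<open>{..<d}\<close>, some
  nontrivial combination \<open>c\<close> of the rows would annihilate all monomials in the
  \<open>x i t\<close>, hence every column of the matrix. A column \<open>j\<close> with
  \<open>c j \<noteq> 0\<close> contradicts this, as only its diagonal entry is nonzero.\<close>

lemma skew_pairs_card_le:
  fixes x y :: "nat \<Rightarrow> nat \<Rightarrow> nat"
  assumes diag: "\<And>i t. i < r \<Longrightarrow> t < d \<Longrightarrow> x i t \<noteq> y i t"
    and off: "\<And>i j. i < r \<Longrightarrow> j < r \<Longrightarrow> i \<noteq> j \<Longrightarrow> \<exists>t<d. x i t = y j t"
  shows "r \<le> 2 ^ d"
proof (rule ccontr)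
  assume "\<not> r \<le> 2 ^ d"
  then have "card (Pow {..<d}) < card {..<r}"
    by (simp add: card_Pow)
  from nontrivial_solution[OF _ _ this, of "\<lambda>i X. \<Prod>t\<in>X. real (x i t)"]
  obtain c :: "nat \<Rightarrow> real" and j where j: "j < r" "c j \<noteq> 0"
    and c: "\<And>X. X \<in> Pow {..<d} \<Longrightarrow> (\<Sum>i<r. c i * (\<Prod>t\<in>X. real (x i t))) = 0"
    by auto
  \<comment> \<open>Column \<open>j\<close> of the matrix, with the difference written as a sum so
    that \<open>prod_add\<close> expands it over subsets.\<close>
  define m where "m i = (\<Prod>t<d. real (x i t) + - real (y j t))" for i
  have "(\<Sum>i<r. c i * m i) =
      (\<Sum>i<r. \<Sum>X\<in>Pow {..<d}. c i * (\<Prod>t\<in>X. real (x i t)) * (\<Prod>t\<in>{..<d} - X. - real (y j t)))"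
    by (simp only: m_def prod_add[OF finite_lessThan] sum_distrib_left mult.assoc)
  also have "\<dots> = (\<Sum>X\<in>Pow {..<d}. (\<Sum>i<r. c i * (\<Prod>t\<in>X. real (x i t))) *
      (\<Prod>t\<in>{..<d} - X. - real (y j t)))"
    by (subst sum.swap) (simp only: sum_distrib_right)
  also have "\<dots> = 0"
    using c by (intro sum.neutral) simp
  finally have "(\<Sum>i<r. c i * m i) = 0" .
  moreover have "m i = 0" if "i < r" "i \<noteq> j" for i
    using off[OF that(1) j(1) that(2)] by (auto simp: m_def)
  then have "(\<Sum>i<r. c i * m i) = (\<Sum>i<r. if i = j then c j * m j else 0)"
    by (intro sum.cong) auto
  ultimately have "m j = 0"
    using j by simp
  with diag[OF j(1)] show False
    by (auto simp: m_def)
qed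

section \<open>Words with prescribed differences\<close>

unbundle bit_operations_syntax

text \<open>\<open>M\<close> is the number of words and \<open>l\<close> their length. If
  \<open>D\<close> contains 0, any two words must also agree somewhere.\<close>

definition xor_separated :: "nat set \<Rightarrow> nat \<Rightarrow> nat \<Rightarrow> bool" where
  "xor_separated D M l \<longleftrightarrow> (\<exists>W :: nat \<Rightarrow> nat \<Rightarrow> nat.
     \<forall>u<M. \<forall>v<M. u \<noteq> v \<longrightarrow> (\<forall>d\<in>D. \<exists>t<l. W u t XOR W v t = d))"

text \<open>Enumerates the functions in \<open>{1..k} \<rightarrow>\<^sub>E {..<M}\<close>. Outside
  \<open>{1..k}\<close> they share one default value, which serves as a sentinel at both
  ends.\<close>

lemma ex_digits:
  fixes M k :: nat
  obtains g :: "nat \<Rightarrow> nat \<Rightarrow> nat" where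
    "\<And>u j. u < M ^ k \<Longrightarrow> j \<in> {1..k} \<Longrightarrow> g u j < M"
    "\<And>u v j. u < M ^ k \<Longrightarrow> v < M ^ k \<Longrightarrow> j \<notin> {1..k} \<Longrightarrow> g u j = g v j"
    "\<And>u v. u < M ^ k \<Longrightarrow> v < M ^ k \<Longrightarrow> u \<noteq> v \<Longrightarrow> \<exists>j\<in>{1..k}. g u j \<noteq> g v j"
proof -
  let ?P = "{1..k} \<rightarrow>\<^sub>E {..<M}"
  have "finite ?P" "card ?P = M ^ k"
    by (auto simp: card_PiE intro: finite_PiE)
  then obtain g where g: "bij_betw g {..<M ^ k} ?P"
    using ex_bij_betw_nat_finite[of ?P] by (auto simp: atLeast0LessThan)
  then have mem: "g u \<in> ?P" if "u < M ^ k" for u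
    using that by (auto simp: bij_betw_def)
  show ?thesis
  proof
    show "g u j < M" if "u < M ^ k" "j \<in> {1..k}" for u j
      using mem[OF that(1)] that(2) by (auto simp: PiE_iff)
    show "g u j = g v j" if "u < M ^ k" "v < M ^ k" "j \<notin> {1..k}" for u v j
      using mem[OF that(1)] mem[OF that(2)] that(3) by (metis PiE_arb)
    show "\<exists>j\<in>{1..k}. g u j \<noteq> g v j" if "u < M ^ k" "v < M ^ k" "u \<noteq> v" for u v
    proof (rule ccontr)
      assume "\<not> ?thesis"
      then have "g u = g v"
        using mem[OF that(1)] mem[OF that(2)] by (intro PiE_ext) auto
      with g that show False
        by (auto simp: bij_betw_def inj_on_def)
    qed
  qed
qed

lemma block_position:
  fixes j k l t :: nat
  assumes "j < k" "t < l"
  shows "j * l + t < k * l" "(j * l + t) div l = j" "(j * l + t) mod l = t"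
proof -
  have "j * l + t < Suc j * l"
    using assms by simp
  also have "\<dots> \<le> k * l"
    using assms by (intro mult_right_mono) auto
  finally show "j * l + t < k * l" .
qed (use assms in auto)

lemma xor_self_left:
  fixes a b :: nat
  shows "a XOR (a XOR b) = b"
  by (simp flip: xor.assoc)

lemma xor_cancel:
  fixes a b c :: nat
  shows "(c XOR a) XOR (c XOR b) = a XOR b" "(a XOR c) XOR (b XOR c) = a XOR b"
  by (simp_all add: ac_simps xor_self_left)

lemma xor_eq_xor_iff:
  fixes a b c d :: nat
  shows "a XOR b = c XOR d \<longleftrightarrow> a XOR c = b XOR d"
  by (metis xor.commute xor.assoc xor_self_left)

text \<open>The words of the \<open>k\<close> digits are concatenated; a block where the digits
  differ already yields all of \<open>D\<close>. The rate \<open>log 2 M / l\<close> is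
  unchanged.\<close>

lemma xor_separated_power:
  assumes "xor_separated D M l"
  shows "xor_separated D (M ^ k) (k * l)"
proof -
  from assms obtain W where W:
    "\<And>u v d. u < M \<Longrightarrow> v < M \<Longrightarrow> u \<noteq> v \<Longrightarrow> d \<in> D \<Longrightarrow> \<exists>t<l. W u t XOR W v t = d"
    unfolding xor_separated_def by blast
  obtain g :: "nat \<Rightarrow> nat \<Rightarrow> nat" where
    g: "\<And>u j. u < M ^ k \<Longrightarrow> j \<in> {1..k} \<Longrightarrow> g u j < M"
      "\<And>u v. u < M ^ k \<Longrightarrow> v < M ^ k \<Longrightarrow> u \<noteq> v \<Longrightarrow> \<exists>j\<in>{1..k}. g u j \<noteq> g v j"
    by (rule ex_digits[of M k]) blast
  \<comment> \<open>Blocks count from 0 and digits from 1, hence the \<open>Suc\<close>.\<close>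
  define W' where "W' u T = W (g u (Suc (T div l))) (T mod l)" for u T
  have "\<exists>T<k * l. W' u T XOR W' v T = d"
    if uv: "u < M ^ k" "v < M ^ k" "u \<noteq> v" and d: "d \<in> D" for u v d
  proof -
    from g(2)[OF uv] obtain i where i: "i \<in> {1..k}" "g u i \<noteq> g v i"
      by blast
    define j where "j = i - 1"
    have j: "j < k" "Suc j = i"
      using i by (auto simp: j_def)
    from W[OF g(1) g(1) i(2) d] uv i obtain t where
      t: "t < l" "W (g u i) t XOR W (g v i) t = d"
      by blast
    with block_position[OF j(1) t(1)] show ?thesis
      by (intro exI[of _ "j * l + t"]) (simp add: W'_def j(2))
  qed
  then show ?thesis
    unfolding xor_separated_def by blast
qed

text \<open>The new value costs one extra block, so the rate drops by the factor
  \<open>k / (k + 1)\<close>. Since \<open>M \<le> 2 ^ l\<close>, one block has room for the binary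
  expansion of an old index.\<close>

lemma xor_separated_insert:
  assumes "xor_separated D M l" "M \<le> 2 ^ l"
  shows "xor_separated (insert d D) (M ^ k) (Suc k * l)"
proof -
  from assms obtain W where W:
    "\<And>u v d. u < M \<Longrightarrow> v < M \<Longrightarrow> u \<noteq> v \<Longrightarrow> d \<in> D \<Longrightarrow> \<exists>t<l. W u t XOR W v t = d"
    unfolding xor_separated_def by blast
  obtain g :: "nat \<Rightarrow> nat \<Rightarrow> nat" where
    g: "\<And>u j. u < M ^ k \<Longrightarrow> j \<in> {1..k} \<Longrightarrow> g u j < M"
      "\<And>u v j. u < M ^ k \<Longrightarrow> v < M ^ k \<Longrightarrow> j \<notin> {1..k} \<Longrightarrow> g u j = g v j"
      "\<And>u v. u < M ^ k \<Longrightarrow> v < M ^ k \<Longrightarrow> u \<noteq> v \<Longrightarrow> \<exists>j\<in>{1..k}. g u j \<noteq> g v j"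
    by (rule ex_digits[of M k]) blast
  define mark where "mark n t = (if bit n t then d else 0)" for n t :: nat
  define W' where
    "W' u T = W (g u (T div l)) (T mod l) XOR mark (g u (Suc (T div l))) (T mod l)" for u T
  have "\<exists>T<Suc k * l. W' u T XOR W' v T = e"
    if uv: "u < M ^ k" "v < M ^ k" "u \<noteq> v" and e: "e \<in> insert d D" for u v e
  proof -
    define B where "B = {i. g u i \<noteq> g v i}"
    have B: "B \<subseteq> {1..k}" "B \<noteq> {}"
      using g(2)[OF uv(1,2)] g(3)[OF uv] unfolding B_def by blast+
    then have "finite B"
      using finite_subset by blast
    show ?thesis
    proof (cases "e = d")
      case True
      \<comment> \<open>In block \<open>i - 1\<close> the old words agree and cancel. The marks XOR
        to \<open>d\<close> wherever the expansions of the two digits \<open>i\<close>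
        differ.\<close>
      define i where "i = Min B"
      have i: "i \<in> B" and least: "\<And>i'. i' \<in> B \<Longrightarrow> i \<le> i'"
        using B \<open>finite B\<close> by (auto simp: i_def)
      define j where "j = i - 1"
      have ik: "i \<in> {1..k}"
        using i B by auto
      then have j: "j < Suc k" "Suc j = i"
        by (auto simp: j_def)
      have "j \<notin> B"
        using least[of j] j by auto
      then have eq: "g u j = g v j"
        by (simp add: B_def)
      have "g u i < 2 ^ l" "g v i < 2 ^ l"
        using g(1)[OF uv(1) ik] g(1)[OF uv(2) ik] assms(2) by auto
      moreover have "g u i \<noteq> g v i"
        using i by (simp add: B_def)
      ultimately obtain t where t: "t < l" "bit (g u i) t \<noteq> bit (g v i) t"
        by (metis bit_eqI bit_take_bit_iff take_bit_nat_eq_self)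
      then have "W' u (j * l + t) XOR W' v (j * l + t) = d"
        using block_position[OF j(1) t(1)]
        by (auto simp: W'_def j(2) eq xor_cancel mark_def)
      with block_position[OF j(1) t(1)] True show ?thesis
        by blast
    next
      case False
      \<comment> \<open>In block \<open>i\<close> the marks agree and cancel, since digit
        \<open>i + 1\<close> is the same for both.\<close>
      define i where "i = Max B"
      have i: "i \<in> B" and greatest: "\<And>i'. i' \<in> B \<Longrightarrow> i' \<le> i"
        using B \<open>finite B\<close> by (auto simp: i_def)
      have ik: "i \<in> {1..k}" "i < Suc k"
        using i B by auto
      have eq: "g u (Suc i) = g v (Suc i)"
        using greatest[of "Suc i"] by (auto simp: B_def)
      have "g u i \<noteq> g v i" "e \<in> D"
        using i e False by (auto simp: B_def)
      from W[OF g(1)[OF uv(1) ik(1)] g(1)[OF uv(2) ik(1)] this] obtain t where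
        t: "t < l" "W (g u i) t XOR W (g v i) t = e"
        by blast
      have "W' u (i * l + t) XOR W' v (i * l + t) = e"
        using block_position[OF ik(2) t(1)] t(2)
        by (simp add: W'_def eq xor_cancel)
      with block_position[OF ik(2) t(1)] show ?thesis
        by blast
    qed
  qed
  then show ?thesis
    unfolding xor_separated_def by blast
qed

text \<open>Starts from two words of length 1 and inserts the values one by one. The final rate
  \<open>(k / (k + 1)) ^ card D\<close> tends to 1 as \<open>k\<close> grows.\<close>

lemma xor_separated_exists:
  assumes "finite D"
  shows "xor_separated D (2 ^ (k ^ card D)) (Suc k ^ card D)"
  using assms
proof (induction D rule: finite_induct)
  case empty
  show ?case
    by (simp add: xor_separated_def)
next
  case (insert d D)
  have "k ^ card D \<le> Suc k ^ card D"
    by (intro power_mono) auto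
  then have "(2::nat) ^ (k ^ card D) \<le> 2 ^ (Suc k ^ card D)"
    by (intro power_increasing) auto
  from xor_separated_insert[OF insert.IH this, of d k] show ?case
    using insert.hyps by (simp add: power_mult[symmetric] mult.commute)
qed

section \<open>The product dimension of \<open>K\<^sub>s(r)\<close>\<close>

definition Ksr_realizable :: "nat \<Rightarrow> nat \<Rightarrow> nat \<Rightarrow> bool" where
  "Ksr_realizable s r d \<longleftrightarrow> (\<exists>c :: nat \<Rightarrow> nat \<times> nat \<Rightarrow> nat.
     (\<forall>i<d. proper_coloring (Ksr_vertices s r) Ksr_adj (c i)) \<and>
     (\<forall>u\<in>Ksr_vertices s r. \<forall>v\<in>Ksr_vertices s r.
        u \<noteq> v \<and> \<not> Ksr_adj u v \<longrightarrow> (\<exists>i<d. c i u = c i v)))"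

lemma Q_eq_Least: "Q s r = (LEAST d. Ksr_realizable s r d)"
  by (simp add: Q_def product_dimension_def Ksr_realizable_def)

text \<open>Vertices 0 and 1 of each clique supply the two families of colour vectors.\<close>

lemma realizable_imp_le_power:
  assumes "Ksr_realizable s r d" "s \<ge> 2"
  shows "r \<le> 2 ^ d"
proof -
  from assms(1) obtain c :: "nat \<Rightarrow> nat \<times> nat \<Rightarrow> nat" where
    c: "\<forall>i<d. proper_coloring (Ksr_vertices s r) Ksr_adj (c i)"
      "\<forall>u\<in>Ksr_vertices s r. \<forall>v\<in>Ksr_vertices s r.
        u \<noteq> v \<and> \<not> Ksr_adj u v \<longrightarrow> (\<exists>i<d. c i u = c i v)"
    unfolding Ksr_realizable_def by (elim exE conjE)
  show ?thesis
  proof (rule skew_pairs_card_le[where x = "\<lambda>i t. c t (i, 0)" and y = "\<lambda>i t. c t (i, 1)"])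
    show "c t (i, 0) \<noteq> c t (i, 1)" if "i < r" "t < d" for i t
      using c(1) that assms(2)
      by (auto simp: proper_coloring_def Ksr_vertices_def Ksr_adj_def)
    show "\<exists>t<d. c t (i, 0) = c t (j, 1)" if "i < r" "j < r" "i \<noteq> j" for i j
      using c(2)[THEN bspec[of _ _ "(i, 0)"], THEN bspec[of _ _ "(j, 1)"]] that assms(2)
      by (auto simp: Ksr_vertices_def Ksr_adj_def)
  qed
qed

text \<open>XOR with a fixed word entry is injective, so each colouring is proper. Colours of two
  cliques agree exactly where the XOR of their entries is \<open>2 ^ a XOR 2 ^ b\<close>.\<close>

lemma realizable_of_separated:
  assumes "xor_separated {2 ^ a XOR 2 ^ b | a b. a < s \<and> b < s} M l" "r \<le> M"
  shows "Ksr_realizable s r l"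
proof -
  let ?D = "{2 ^ a XOR 2 ^ b | a b. a < s \<and> b < s} :: nat set"
  from assms(1) obtain W where sep:
    "\<forall>u<M. \<forall>v<M. u \<noteq> v \<longrightarrow> (\<forall>d\<in>?D. \<exists>t<l. W u t XOR W v t = d)"
    unfolding xor_separated_def by (elim exE)
  have W: "\<exists>t<l. W u t XOR W v t = 2 ^ a XOR 2 ^ b"
    if "u < r" "v < r" "u \<noteq> v" "a < s" "b < s" for u v a b
  proof -
    have "2 ^ a XOR 2 ^ b \<in> ?D"
      using that by blast
    moreover have "u < M" "v < M"
      using that assms(2) by auto
    ultimately show ?thesis
      using sep that(3) by blast
  qed
  define c where "c t u = W (fst u) t XOR 2 ^ snd u" for t and u :: "nat \<times> nat"
  have "proper_coloring (Ksr_vertices s r) Ksr_adj (c t)" for t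
  proof -
    have False if "w XOR 2 ^ a = w XOR 2 ^ b" "a \<noteq> b" for w a b :: nat
    proof -
      have "2 ^ a = (2 ^ b :: nat)"
        using that(1) by (metis xor_self_left)
      with that(2) show False
        by simp
    qed
    then show ?thesis
      by (auto simp: proper_coloring_def Ksr_adj_def c_def)
  qed
  moreover have "\<exists>t<l. c t u = c t v"
    if "u \<in> Ksr_vertices s r" "v \<in> Ksr_vertices s r" "u \<noteq> v" "\<not> Ksr_adj u v" for u v
  proof -
    have "fst u < r" "fst v < r" "fst u \<noteq> fst v" "snd u < s" "snd v < s"
      using that by (auto simp: Ksr_vertices_def Ksr_adj_def prod_eq_iff)
    from W[OF this] obtain t where
      "t < l" "W (fst u) t XOR W (fst v) t = 2 ^ snd u XOR 2 ^ snd v"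
      by blast
    then show ?thesis
      unfolding c_def by (subst xor_eq_xor_iff) blast
  qed
  ultimately show ?thesis
    unfolding Ksr_realizable_def by blast
qed

text \<open>Here \<open>m\<close> is the number of required values, so it depends on
  \<open>s\<close> only. Growing \<open>n\<close> with \<open>k\<close> fixed reaches every
  \<open>r\<close> at a constant rate when \<open>k\<close> is positive.\<close>

lemma Ksr_realizable_exists:
  obtains m where
    "\<And>k n r. r \<le> 2 ^ (k ^ m * n) \<Longrightarrow> Ksr_realizable s r (n * Suc k ^ m)"
proof -
  define D :: "nat set" where "D = {2 ^ a XOR 2 ^ b | a b. a < s \<and> b < s}"
  have "D = (\<lambda>(a, b). 2 ^ a XOR 2 ^ b) ` ({..<s} \<times> {..<s})"
    by (auto simp: D_def)
  then have "finite D"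
    by simp
  from xor_separated_power[OF xor_separated_exists[OF this]]
  have "xor_separated D (2 ^ (k ^ card D * n)) (n * Suc k ^ card D)" for k n
    by (simp add: power_mult)
  from realizable_of_separated[OF this[unfolded D_def]] show ?thesis
    by (intro that) auto
qed

section \<open>Asymptotics of \<open>Q s r\<close>\<close>

lemma log_le_Q:
  assumes "s \<ge> 2" "r \<ge> 1"
  shows "log 2 (real r) \<le> real (Q s r)"
proof -
  obtain m where m: "\<And>k n r. r \<le> 2 ^ (k ^ m * n) \<Longrightarrow> Ksr_realizable s r (n * Suc k ^ m)"
    using Ksr_realizable_exists by blast
  \<comment> \<open>A crude instance showing that some dimension is realizable, so the least one is
    attained.\<close>
  have "r \<le> 2 ^ (1 ^ m * r)"
    by (simp add: less_imp_le)
  from m[OF this] have "Ksr_realizable s r (Q s r)"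
    unfolding Q_eq_Least by (rule LeastI)
  from realizable_imp_le_power[OF this assms(1)] have "real r \<le> 2 ^ Q s r"
    by (metis of_nat_le_iff of_nat_numeral of_nat_power)
  then show ?thesis
    using assms(2) by (simp add: log_le_iff powr_realpow)
qed

lemma Q_le_log:
  obtains m where
    "\<And>k r. k \<ge> 1 \<Longrightarrow> r \<ge> 1 \<Longrightarrow>
      real (Q s r) \<le> (real (Suc k) / real k) ^ m * log 2 (real r) + real (Suc k) ^ m"
proof -
  obtain m where m: "\<And>k n r. r \<le> 2 ^ (k ^ m * n) \<Longrightarrow> Ksr_realizable s r (n * Suc k ^ m)"
    using Ksr_realizable_exists by blast
  have "real (Q s r) \<le> (real (Suc k) / real k) ^ m * log 2 (real r) + real (Suc k) ^ m"
    if "k \<ge> 1" "r \<ge> 1" for k r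
  proof -
    define x where "x = log 2 (real r) / real k ^ m"
    \<comment> \<open>Rounding up costs at most one more repetition, which is the additive term
      \<open>real (Suc k) ^ m\<close>.\<close>
    define n where "n = nat \<lceil>x\<rceil>"
    have "x \<ge> 0"
      using that by (simp add: x_def)
    then have n: "x \<le> real n" "real n \<le> x + 1"
      unfolding n_def by linarith+
    have "log 2 (real r) \<le> real (k ^ m * n)"
      using n(1) that by (simp add: x_def field_simps)
    then have "real r \<le> 2 ^ (k ^ m * n)"
      using that by (simp add: log_le_iff powr_realpow del: of_nat_mult)
    then have "r \<le> 2 ^ (k ^ m * n)"
      by (metis of_nat_le_iff of_nat_numeral of_nat_power)
    from m[OF this] have "Q s r \<le> n * Suc k ^ m"
      unfolding Q_eq_Least by (rule Least_le)
    then have "real (Q s r) \<le> real n * real (Suc k) ^ m"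
      by (metis of_nat_le_iff of_nat_mult of_nat_power)
    also have "\<dots> \<le> (x + 1) * real (Suc k) ^ m"
      using n(2) by (intro mult_right_mono) auto
    also have "\<dots> = (real (Suc k) / real k) ^ m * log 2 (real r) + real (Suc k) ^ m"
      by (simp add: x_def power_divide algebra_simps)
    finally show ?thesis .
  qed
  then show ?thesis
    by (rule that)
qed

theorem theorem1p1:
  fixes s :: nat and \<delta> :: real
  assumes "s \<ge> 2" and "\<delta> > 0"
  shows "\<exists>r0::nat. \<forall>r\<ge>r0.
           (1 - \<delta>) * log 2 (real r) \<le> real (Q s r) \<and>
           real (Q s r) \<le> (1 + \<delta>) * log 2 (real r)"
proof -
  obtain m where m: "\<And>k r. k \<ge> 1 \<Longrightarrow> r \<ge> 1 \<Longrightarrow>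
      real (Q s r) \<le> (real (Suc k) / real k) ^ m * log 2 (real r) + real (Suc k) ^ m"
    using Q_le_log by blast
  \<comment> \<open>Half of \<open>\<delta>\<close> is spent on the leading factor by fixing a large
    \<open>k\<close>; the other half absorbs the additive term once \<open>r\<close> is
    large.\<close>
  have "(\<lambda>k. (real (Suc k) / real k) ^ m) \<longlonglongrightarrow> 1 ^ m"
    by (intro tendsto_power LIMSEQ_Suc_n_over_n)
  then have "\<forall>\<^sub>F k in sequentially. (real (Suc k) / real k) ^ m < 1 + \<delta> / 2"
    using assms(2) by (intro order_tendstoD) auto
  then have "\<forall>\<^sub>F k in sequentially. k \<ge> 1 \<and> (real (Suc k) / real k) ^ m < 1 + \<delta> / 2"
    by (intro eventually_conj eventually_ge_at_top)
  then obtain k where k: "k \<ge> 1" "(real (Suc k) / real k) ^ m < 1 + \<delta> / 2"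
    using eventually_happens by fastforce
  define r1 where "r1 = nat \<lceil>2 powr (real (Suc k) ^ m * 2 / \<delta>)\<rceil>"
  have r1: "log 2 (real r) \<ge> real (Suc k) ^ m * 2 / \<delta>" if "r \<ge> r1" "r \<ge> 1" for r
  proof -
    have "2 powr (real (Suc k) ^ m * 2 / \<delta>) \<le> real r"
      using that(1) unfolding r1_def by linarith
    then show ?thesis
      using that(2) by (simp add: le_log_iff)
  qed
  have "(1 - \<delta>) * log 2 (real r) \<le> real (Q s r) \<and> real (Q s r) \<le> (1 + \<delta>) * log 2 (real r)"
    if "r \<ge> max 1 r1" for r
  proof
    have r: "r \<ge> 1" "r \<ge> r1"
      using that by auto
    then have L: "log 2 (real r) \<ge> 0"
      by simp
    have "(1 - \<delta>) * log 2 (real r) \<le> 1 * log 2 (real r)"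
      using assms(2) L by (intro mult_right_mono) auto
    also have "\<dots> \<le> real (Q s r)"
      using log_le_Q[OF assms(1) r(1)] by simp
    finally show "(1 - \<delta>) * log 2 (real r) \<le> real (Q s r)" .
    have "real (Q s r) \<le> (real (Suc k) / real k) ^ m * log 2 (real r) + real (Suc k) ^ m"
      by (rule m[OF k(1) r(1)])
    also have "\<dots> \<le> (1 + \<delta> / 2) * log 2 (real r) + \<delta> / 2 * log 2 (real r)"
    proof (rule add_mono)
      show "(real (Suc k) / real k) ^ m * log 2 (real r) \<le> (1 + \<delta> / 2) * log 2 (real r)"
        using k(2) L by (intro mult_right_mono) auto
      show "real (Suc k) ^ m \<le> \<delta> / 2 * log 2 (real r)"
        using r1[OF r(2,1)] assms(2) by (simp add: field_simps)
    qed
    also have "\<dots> = (1 + \<delta>) * log 2 (real r)"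
      by (simp add: algebra_simps)
    finally show "real (Q s r) \<le> (1 + \<delta>) * log 2 (real r)" .
  qed
  then show ?thesis
    by blast
qed

end
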